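(* Let $n$ be a positive integer, and let $x_i$ ($i=1,2,\dots,2n$) be indeterminates. Then $$\operatorname{Pf}_\lambda\bigl(x_i-x_j\bigr)_{1\le i<j\le 2n}=(1-\lambda)^{n-1}\prod_{i=1}^n(x_{2i-1}-x_{2i}).$$
   Context: $\lambda$ is an indeterminate. For an array $(A_{ij})_{1\le i<j\le 2n}$ (the strictly upper triangular part of a skew-symmetric matrix of size $2n$), the $\lambda$-Pfaffian is $$\operatorname{Pf}_\lambda(A_{ij})_{1\le i<j\le 2n}=\sum_{m\in\mathcal M([2n])}(-1)^{\mathrm{cross}(m)}\,\lambda^{\mathrm{cross}(m)+\mathrm{nest}(m)}\prod_{i=1}^n A_{m_{2i-1}m_{2i}}.$$ Here $\mathcal M([2n])$ is the set of perfect matchings of $[2n]=\{1,\dots,2n\}$, written $m=((m_1,m_2),\dots,(m_{2n-1},m_{2n}))$ with $m_{2i-1}<m_{2i}$ for all $i$ and $m_1<m_3<\cdots<m_{2n-1}$. $\mathrm{cross}(m)$ is the number of (unordered) pairs of pairs $(a,b),(c,d)$ in $m$ with $a<c<b<d$; $\mathrm{nest}(m)$ is the number of pairs of pairs $(a,b),(c,d)$ in $m$ with $a<c<d<b$. *)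

theory Defs
  imports Main
begin

text \<open>
  A perfect matching of \<open>{1..2*n}\<close> is the set of its pairs, each pair \<open>(a, b)\<close> being
  written with \<open>a < b\<close>. Listing the pairs by increasing first component gives the sequence
  \<open>((m\<^sub>1, m\<^sub>2), \<dots>)\<close>.
\<close>

definition perfect_matchings :: "nat \<Rightarrow> (nat \<times> nat) set set" where
  "perfect_matchings n =
     {M. M \<subseteq> {(a, b). 1 \<le> a \<and> a < b \<and> b \<le> 2 * n} \<and>
         (\<forall>i\<in>{1..2 * n}. \<exists>!p. p \<in> M \<and> (i = fst p \<or> i = snd p))}"

text \<open>
  The condition \<open>a < c\<close> orders the two pairs involved, so the cardinalities below count
  every unordered pair of pairs once.
\<close>

definition cross :: "(nat \<times> nat) set \<Rightarrow> nat" where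
  "cross M = card {((a, b), (c, d)). (a, b) \<in> M \<and> (c, d) \<in> M \<and> a < c \<and> c < b \<and> b < d}"

definition nest :: "(nat \<times> nat) set \<Rightarrow> nat" where
  "nest M = card {((a, b), (c, d)). (a, b) \<in> M \<and> (c, d) \<in> M \<and> a < c \<and> c < d \<and> d < b}"

text \<open>
  The array has size \<open>2*n\<close>; only the entries \<open>A i j\<close> with \<open>1 \<le> i < j \<le> 2*n\<close> are used.
\<close>

definition lambda_Pf :: "'a::comm_ring_1 \<Rightarrow> nat \<Rightarrow> (nat \<Rightarrow> nat \<Rightarrow> 'a) \<Rightarrow> 'a" where
  "lambda_Pf l n A =
     (\<Sum>M\<in>perfect_matchings n.
        (- 1) ^ cross M * l ^ (cross M + nest M) * (\<Prod>(a, b)\<in>M. A a b))"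

lemma perfect_matching_subset: "M \<in> perfect_matchings n \<Longrightarrow> M \<subseteq> {1..2 * n} \<times> {1..2 * n}"
  unfolding perfect_matchings_def by fastforce

lemma finite_perfect_matching: "M \<in> perfect_matchings n \<Longrightarrow> finite M"
  by (rule finite_subset[OF perfect_matching_subset]) auto

lemma finite_perfect_matchings: "finite (perfect_matchings n)"
proof (rule finite_subset)
  show "perfect_matchings n \<subseteq> Pow ({1..2 * n} \<times> {1..2 * n})"
    using perfect_matching_subset by blast
qed simp

end

theory Submission
  imports Defs
begin

text \<open>
  Sweep the points from left to right. Closing one of \<open>h\<close> open endpoints contributes the factor
  \<open>\<lambda>\<^sup>h\<^sup>-\<^sup>1\<close>, whichever endpoint is matched, and the sign \<open>(-1)\<^sup>r\<close> where \<open>r\<close> of the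
  open endpoints lie to the right of the matched one. Up to powers of \<open>\<lambda>\<close> this is contraction on
  an exterior algebra, in which, for the array \<open>x i - x j\<close>, an endpoint \<open>a\<close> acts as the vector
  \<open>(1, x a)\<close> of a free module of rank two. So three or more open endpoints contribute nothing, and
  following the degrees 0, 1 and 2 shows that each further pair of consecutive points multiplies
  the sum by \<open>(1 - \<lambda>) (x (2 i - 1) - x (2 i))\<close>.
\<close>

section \<open>Perfect matchings of an arbitrary set of points\<close>

definition matchings :: "nat set \<Rightarrow> (nat \<times> nat) set set" where
  "matchings S =
     {M. M \<subseteq> {(a, b). a \<in> S \<and> b \<in> S \<and> a < b} \<and>
         (\<forall>i\<in>S. \<exists>!p. p \<in> M \<and> (i = fst p \<or> i = snd p))}"

text \<open>Arbitrary point sets are needed because deleting an arc together with both endpoints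
  leaves gaps in \<open>{1..2 * n}\<close>.\<close>

lemma perfect_matchings_eq_matchings: "perfect_matchings n = matchings {1..2 * n}"
proof -
  have "{(a, b). 1 \<le> a \<and> a < b \<and> b \<le> 2 * n}
      = {(a, b). a \<in> {1..2 * n} \<and> b \<in> {1..2 * n} \<and> a < b}"
    by auto
  then show ?thesis
    unfolding perfect_matchings_def matchings_def by simp
qed

lemma matchings_pair:
  assumes "M \<in> matchings S" "(a, b) \<in> M"
  shows "a \<in> S" "b \<in> S" "a < b"
  using assms unfolding matchings_def by auto

lemma matchings_obtain:
  assumes "M \<in> matchings S" "i \<in> S"
  obtains a b where "(a, b) \<in> M" "i = a \<or> i = b"
proof -
  have "\<exists>!p. p \<in> M \<and> (i = fst p \<or> i = snd p)"
    using assms unfolding matchings_def by blast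
  then obtain p where "p \<in> M" "i = fst p \<or> i = snd p"
    by blast
  then show thesis
    using that[of "fst p" "snd p"] by simp
qed

lemma matchings_unique:
  assumes "M \<in> matchings S" "(a, b) \<in> M" "(c, d) \<in> M" "i = a \<or> i = b" "i = c \<or> i = d"
  shows "a = c \<and> b = d"
proof -
  have "i \<in> S"
    using assms(1,2,4) matchings_pair by blast
  then have "\<exists>!p. p \<in> M \<and> (i = fst p \<or> i = snd p)"
    using assms(1) unfolding matchings_def by blast
  then have "(a, b) = (c, d)"
    using assms(2-) by (metis fst_conv snd_conv)
  then show ?thesis by simp
qed

lemma matchingsI:
  assumes "\<And>a b. (a, b) \<in> M \<Longrightarrow> a \<in> S \<and> b \<in> S \<and> a < b"
    and "\<And>i. i \<in> S \<Longrightarrow> \<exists>a b. (a, b) \<in> M \<and> (i = a \<or> i = b)"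
    and "\<And>i a b c d. \<lbrakk>(a, b) \<in> M; (c, d) \<in> M; i = a \<or> i = b; i = c \<or> i = d\<rbrakk> \<Longrightarrow> a = c \<and> b = d"
  shows "M \<in> matchings S"
proof -
  have "\<exists>!p. p \<in> M \<and> (i = fst p \<or> i = snd p)" if "i \<in> S" for i
  proof -
    obtain a b where ab: "(a, b) \<in> M" "i = a \<or> i = b"
      using assms(2)[OF \<open>i \<in> S\<close>] by blast
    show ?thesis
    proof (rule ex1I[of _ "(a, b)"])
      fix p assume "p \<in> M \<and> (i = fst p \<or> i = snd p)"
      then show "p = (a, b)"
        using assms(3)[OF _ ab(1) _ ab(2), of "fst p" "snd p"] by (cases p) auto
    qed (use ab in auto)
  qed
  then show ?thesis
    using assms(1) unfolding matchings_def by auto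
qed

lemma matchings_insert:
  assumes "M \<in> matchings S" "a \<notin> S" "b \<notin> S" "a < b"
  shows "insert (a, b) M \<in> matchings (insert a (insert b S))"
proof (rule matchingsI)
  fix c d assume "(c, d) \<in> insert (a, b) M"
  then show "c \<in> insert a (insert b S) \<and> d \<in> insert a (insert b S) \<and> c < d"
    using matchings_pair[OF assms(1)] assms(4) by blast
next
  fix i assume "i \<in> insert a (insert b S)"
  then show "\<exists>c d. (c, d) \<in> insert (a, b) M \<and> (i = c \<or> i = d)"
    using matchings_obtain[OF assms(1), of i] by blast
next
  fix i c d e f
  assume *: "(c, d) \<in> insert (a, b) M" "(e, f) \<in> insert (a, b) M" "i = c \<or> i = d" "i = e \<or> i = f"
  consider "(c, d) = (a, b)" "(e, f) = (a, b)" | "(c, d) = (a, b)" "(e, f) \<in> M"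
    | "(c, d) \<in> M" "(e, f) = (a, b)" | "(c, d) \<in> M" "(e, f) \<in> M"
    using * by blast
  then show "c = e \<and> d = f"
  proof cases
    case 1 then show ?thesis by simp
  next
    case 2 then show ?thesis
      using * matchings_pair[OF assms(1)] assms(2,3) by auto
  next
    case 3 then show ?thesis
      using * matchings_pair[OF assms(1)] assms(2,3) by auto
  next
    case 4 then show ?thesis
      using * matchings_unique[OF assms(1)] by blast
  qed
qed

lemma matchings_remove:
  assumes "M \<in> matchings S" "(a, b) \<in> M"
  shows "M - {(a, b)} \<in> matchings (S - {a, b})"
proof (rule matchingsI)
  fix c d assume cd: "(c, d) \<in> M - {(a, b)}"
  then have "c \<notin> {a, b}" "d \<notin> {a, b}"
    using matchings_unique[OF assms(1,2), of c d] by blast+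
  then show "c \<in> S - {a, b} \<and> d \<in> S - {a, b} \<and> c < d"
    using cd matchings_pair[OF assms(1)] by blast
next
  fix i assume i: "i \<in> S - {a, b}"
  then obtain c d where "(c, d) \<in> M" "i = c \<or> i = d"
    using matchings_obtain[OF assms(1), of i] by blast
  then show "\<exists>c d. (c, d) \<in> M - {(a, b)} \<and> (i = c \<or> i = d)"
    using i by blast
next
  fix i c d e f
  assume "(c, d) \<in> M - {(a, b)}" "(e, f) \<in> M - {(a, b)}" "i = c \<or> i = d" "i = e \<or> i = f"
  then show "c = e \<and> d = f"
    using matchings_unique[OF assms(1)] by blast
qed

lemma finite_matching:
  assumes "finite S" "M \<in> matchings S"
  shows "finite M"
  by (rule finite_subset[of _ "S \<times> S"]) (use assms matchings_pair in auto)

lemma finite_matchings: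
  assumes "finite S"
  shows "finite (matchings S)"
  by (rule finite_subset[of _ "Pow (S \<times> S)"]) (use assms matchings_pair in auto)

section \<open>Crossings and nestings created by an arc that closes first\<close>

lemma cross_insert:
  assumes "finite M" "\<And>p. p \<in> M \<Longrightarrow> z < snd p"
  shows "cross (insert (a, z) M) = cross M + card {p \<in> M. a < fst p \<and> fst p < z}"
proof -
  let ?X = "{((a, b), (c, d)). (a, b) \<in> M \<and> (c, d) \<in> M \<and> a < c \<and> c < b \<and> b < d}"
  \<comment> \<open>Every arc of \<open>M\<close> ends after \<open>z\<close>, so
    \<open>(a, z)\<close> can only be the arc that starts first in a new crossing, and the condition
    on the right ends is automatic.\<close>
  let ?Y = "Pair (a, z) ` {p \<in> M. a < fst p \<and> fst p < z}"
  have "finite ?X"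
    by (rule finite_subset[of _ "M \<times> M"]) (use assms(1) in auto)
  moreover have "?X \<inter> ?Y = {}"
    using assms(2) by fastforce
  moreover have "card ?Y = card {p \<in> M. a < fst p \<and> fst p < z}"
    by (rule card_image) (simp add: inj_on_def)
  moreover have "{((c, b), (e, d)). (c, b) \<in> insert (a, z) M \<and> (e, d) \<in> insert (a, z) M
      \<and> c < e \<and> e < b \<and> b < d} = ?X \<union> ?Y"
    using assms(2) by (fastforce simp: image_iff)
  ultimately show ?thesis
    unfolding cross_def using assms(1) by (simp add: card_Un_disjoint)
qed

text \<open>Since \<open>(a, z)\<close> closes before all arcs of \<open>M\<close>, it encloses none
  of them, and it is enclosed by exactly those that start before \<open>a\<close>.\<close>

lemma nest_insert:
  assumes "finite M" "\<And>p. p \<in> M \<Longrightarrow> z < snd p" "a < z"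
  shows "nest (insert (a, z) M) = nest M + card {p \<in> M. fst p < a}"
proof -
  let ?X = "{((a, b), (c, d)). (a, b) \<in> M \<and> (c, d) \<in> M \<and> a < c \<and> c < d \<and> d < b}"
  let ?Y = "(\<lambda>p. (p, (a, z))) ` {p \<in> M. fst p < a}"
  have "finite ?X"
    by (rule finite_subset[of _ "M \<times> M"]) (use assms(1) in auto)
  moreover have "?X \<inter> ?Y = {}"
    using assms(2) by fastforce
  moreover have "card ?Y = card {p \<in> M. fst p < a}"
    by (rule card_image) (simp add: inj_on_def)
  moreover have "{((c, b), (e, d)). (c, b) \<in> insert (a, z) M \<and> (e, d) \<in> insert (a, z) M
      \<and> c < e \<and> e < d \<and> d < b} = ?X \<union> ?Y"
    using assms(2,3) by (fastforce simp: image_iff)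
  ultimately show ?thesis
    unfolding nest_def using assms(1) by (simp add: card_Un_disjoint)
qed

section \<open>Matchings that complete a set \<open>Y\<close> of open left endpoints\<close>

definition completions :: "nat set \<Rightarrow> nat set \<Rightarrow> (nat \<times> nat) set set" where
  "completions Y R = {M \<in> matchings (Y \<union> R). \<forall>p\<in>M. snd p \<notin> Y}"

lemma finite_completions: "finite Y \<Longrightarrow> finite R \<Longrightarrow> finite (completions Y R)"
  unfolding completions_def by (simp add: finite_matchings)

lemma completions_snd:
  "M \<in> completions Y R \<Longrightarrow> p \<in> M \<Longrightarrow> snd p \<in> R"
  unfolding completions_def using matchings_pair(2)[of M "Y \<union> R" "fst p" "snd p"] by auto

text \<open>No point of \<open>Y\<close> is a right end, so each starts exactly one arc. Counts of
  arcs thus become counts of open endpoints, independent of the matching.\<close>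

lemma card_completion_fst:
  assumes "M \<in> completions Y R" "B \<subseteq> Y"
  shows "card {p \<in> M. fst p \<in> B} = card B"
proof (rule bij_betw_same_card[of fst])
  have M: "M \<in> matchings (Y \<union> R)"
    using assms(1) by (simp add: completions_def)
  have "inj_on fst {p \<in> M. fst p \<in> B}"
  proof (rule inj_onI)
    fix p q assume "p \<in> {p \<in> M. fst p \<in> B}" "q \<in> {p \<in> M. fst p \<in> B}" "fst p = fst q"
    then show "p = q"
      using matchings_unique[OF M, of "fst p" "snd p" "fst q" "snd q" "fst p"]
      by (cases p; cases q) simp
  qed
  moreover have "fst ` {p \<in> M. fst p \<in> B} = B"
  proof (intro equalityI subsetI)
    fix b assume b: "b \<in> B"
    then obtain c d where cd: "(c, d) \<in> M" "b = c \<or> b = d"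
      using matchings_obtain[OF M, of b] assms(2) by blast
    have "d \<notin> Y"
      using assms(1) cd(1) unfolding completions_def by auto
    then have "b = c"
      using cd(2) b assms(2) by blast
    then show "b \<in> fst ` {p \<in> M. fst p \<in> B}"
      using b cd by force
  qed auto
  ultimately show "bij_betw fst {p \<in> M. fst p \<in> B} B"
    by (simp add: bij_betw_def)
qed

text \<open>The next point \<open>z\<close> either opens an arc and joins the waiting endpoints, or
  closes the arc of some waiting \<open>a\<close>, which then leaves them.\<close>

lemma completions_insert:
  assumes "\<And>y. y \<in> Y \<Longrightarrow> y < z" "\<And>r. r \<in> R \<Longrightarrow> z < r"
  shows "completions Y (insert z R) =
    completions (insert z Y) R \<union> (\<Union>a\<in>Y. insert (a, z) ` completions (Y - {a}) R)"
proof (intro equalityI subsetI)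
  fix M assume "M \<in> completions Y (insert z R)"
  then have M: "M \<in> matchings (Y \<union> insert z R)" and snd: "\<And>p. p \<in> M \<Longrightarrow> snd p \<notin> Y"
    by (auto simp: completions_def)
  obtain a b where ab: "(a, b) \<in> M" "z = a \<or> z = b"
    using matchings_obtain[OF M, of z] by blast
  have ab': "a \<in> Y \<union> insert z R" "b \<in> Y \<union> insert z R" "a < b"
    using matchings_pair[OF M ab(1)] by auto
  show "M \<in> completions (insert z Y) R \<union> (\<Union>a\<in>Y. insert (a, z) ` completions (Y - {a}) R)"
  proof (cases "z = a")
    case True
    \<comment> \<open>As \<open>z\<close> already is a left end, it is not a right end too, which is
      what membership in the enlarged waiting set requires.\<close>
    have "snd p \<noteq> z" if "p \<in> M" for p
      using matchings_unique[OF M ab(1), of "fst p" "snd p" z] that True ab'(3) by auto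
    then show ?thesis
      using M snd by (auto simp: completions_def)
  next
    case False
    then have z: "z = b" using ab by simp
    then have a: "a \<in> Y"
      using ab' assms(2)[of a] by fastforce
    have "Y \<union> insert z R - {a, z} = (Y - {a}) \<union> R"
      using a assms by force
    then have "M - {(a, z)} \<in> matchings ((Y - {a}) \<union> R)"
      using matchings_remove[OF M ab(1)] z by simp
    then have "M - {(a, z)} \<in> completions (Y - {a}) R"
      using snd by (auto simp: completions_def)
    moreover have "M = insert (a, z) (M - {(a, z)})"
      using ab z by auto
    ultimately show ?thesis
      using a by blast
  qed
next
  fix M assume "M \<in> completions (insert z Y) R \<union> (\<Union>a\<in>Y. insert (a, z) ` completions (Y - {a}) R)"
  then show "M \<in> completions Y (insert z R)"
  proof
    assume "M \<in> completions (insert z Y) R"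
    then show ?thesis by (auto simp: completions_def)
  next
    assume "M \<in> (\<Union>a\<in>Y. insert (a, z) ` completions (Y - {a}) R)"
    then obtain a M' where a: "a \<in> Y" and M: "M = insert (a, z) M'"
      and M': "M' \<in> completions (Y - {a}) R" by blast
    have "M' \<in> matchings ((Y - {a}) \<union> R)"
      using M' by (simp add: completions_def)
    moreover have "a \<notin> (Y - {a}) \<union> R" "z \<notin> (Y - {a}) \<union> R" "a < z"
      using a assms by force+
    ultimately have "M \<in> matchings (insert a (insert z ((Y - {a}) \<union> R)))"
      unfolding M by (rule matchings_insert)
    moreover have "insert a (insert z ((Y - {a}) \<union> R)) = Y \<union> insert z R"
      using a by auto
    moreover have "snd p \<notin> Y" if "p \<in> M" for p
    proof -
      have "snd p = z \<or> snd p \<in> R"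
        using that M completions_snd[OF M', of p] by auto
      then show ?thesis
        using assms(1)[of "snd p"] assms(2)[of "snd p"] by auto
    qed
    ultimately show ?thesis
      by (simp add: completions_def)
  qed
qed

section \<open>Signed weights and the recursion from left to right\<close>

definition weight :: "'a::comm_ring_1 \<Rightarrow> (nat \<Rightarrow> nat \<Rightarrow> 'a) \<Rightarrow> (nat \<times> nat) set \<Rightarrow> 'a" where
  "weight l A M = (- 1) ^ cross M * l ^ (cross M + nest M) * (\<Prod>(a, b)\<in>M. A a b)"

text \<open>
  The elements of \<open>Y\<close> are the left endpoints still waiting for a partner in \<open>R\<close>.
\<close>

definition completion_sum ::
    "'a::comm_ring_1 \<Rightarrow> (nat \<Rightarrow> nat \<Rightarrow> 'a) \<Rightarrow> nat set \<Rightarrow> nat set \<Rightarrow> 'a" where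
  "completion_sum l A Y R = (\<Sum>M\<in>completions Y R. weight l A M)"

lemma lambda_Pf_eq_completion_sum: "lambda_Pf l n A = completion_sum l A {} {1..2 * n}"
  by (simp add: lambda_Pf_def completion_sum_def completions_def weight_def
      perfect_matchings_eq_matchings)

lemma completion_sum_empty:
  "completion_sum l A Y {} = (if Y = {} then 1 else 0)"
proof -
  have "completions Y {} = (if Y = {} then {{}} else {})"
  proof (cases "Y = {}")
    case True
    then show ?thesis by (auto simp: completions_def matchings_def)
  next
    case False
    have "M \<notin> completions Y {}" for M
    proof
      assume M: "M \<in> completions Y {}"
      then have "M \<in> matchings Y" by (simp add: completions_def)
      then obtain p where "p \<in> M"
        using False matchings_obtain by blast
      then show False using completions_snd[OF M] by blast
    qed
    then show ?thesis using False by auto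
  qed
  moreover have "cross {} = 0" "nest {} = 0"
    by (auto simp: cross_def nest_def card_eq_0_iff)
  ultimately show ?thesis
    by (simp add: completion_sum_def weight_def)
qed

text \<open>Each other open endpoint \<open>c\<close> starts one arc of \<open>M\<close>, which
  crosses \<open>(a, z)\<close> if \<open>a < c\<close> and encloses it if \<open>c < a\<close>.
  Either way it gives one factor \<open>l\<close>, so the choice of \<open>a\<close> affects only
  the sign and the array entry.\<close>

lemma weight_insert:
  assumes "finite Y" "finite R" "\<And>y. y \<in> Y \<Longrightarrow> y < z" "\<And>r. r \<in> R \<Longrightarrow> z < r"
    and "a \<in> Y" "M \<in> completions (Y - {a}) R"
  shows "weight l A (insert (a, z) M) =
    (- 1) ^ card {c \<in> Y. a < c} * l ^ (card Y - 1) * A a z * weight l A M"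
proof -
  have fin: "finite M"
    using assms(1,2,6) finite_matching[of "Y - {a} \<union> R" M] by (simp add: completions_def)
  have snd: "z < snd p" if "p \<in> M" for p
    using completions_snd[OF assms(6) that] assms(4) by blast
  have fst: "fst p \<in> Y - {a} \<or> z < fst p" if "p \<in> M" for p
    using that assms(4,6) matchings_pair(1)[of M "Y - {a} \<union> R" "fst p" "snd p"]
    by (auto simp: completions_def)
  \<comment> \<open>Left ends of \<open>M\<close> outside \<open>Y\<close> lie beyond
    \<open>z\<close>, so only arcs started by open endpoints are counted.\<close>
  have "{p \<in> M. a < fst p \<and> fst p < z} = {p \<in> M. fst p \<in> {c \<in> Y. a < c}}"
    using fst assms(3) by fastforce
  then have cross: "cross (insert (a, z) M) = cross M + card {c \<in> Y. a < c}"
    using cross_insert[OF fin snd, of a] card_completion_fst[OF assms(6), of "{c \<in> Y. a < c}"]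
    by auto
  have "{p \<in> M. fst p < a} = {p \<in> M. fst p \<in> {c \<in> Y. c < a}}"
    using fst assms(3,5) by fastforce
  then have nest: "nest (insert (a, z) M) = nest M + card {c \<in> Y. c < a}"
    using nest_insert[OF fin snd, of a] card_completion_fst[OF assms(6), of "{c \<in> Y. c < a}"]
      assms(3,5) by auto
  have "Y - {a} = {c \<in> Y. a < c} \<union> {c \<in> Y. c < a}"
    by auto
  then have "card (Y - {a}) = card {c \<in> Y. a < c} + card {c \<in> Y. c < a}"
    using assms(1) by (simp add: card_Un_disjoint disjoint_iff)
  then have card: "card Y - 1 = card {c \<in> Y. a < c} + card {c \<in> Y. c < a}"
    using assms(1,5) by simp
  have "(a, z) \<notin> M"
    using snd by fastforce
  then show ?thesis
    unfolding weight_def cross nest card using fin by (simp add: power_add mult_ac)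
qed

lemma completion_sum_insert:
  assumes "finite Y" "finite R" "\<And>y. y \<in> Y \<Longrightarrow> y < z" "\<And>r. r \<in> R \<Longrightarrow> z < r"
  shows "completion_sum l A Y (insert z R) = completion_sum l A (insert z Y) R +
    (\<Sum>a\<in>Y. (- 1) ^ card {c \<in> Y. a < c} * l ^ (card Y - 1) * A a z * completion_sum l A (Y - {a}) R)"
proof -
  let ?C = "\<lambda>a. insert (a, z) ` completions (Y - {a}) R"
  \<comment> \<open>As \<open>z\<close> is not in \<open>R\<close>, no completion closes an arc at
    \<open>z\<close>. Hence the arc ending at \<open>z\<close> identifies its family, and adding it
    is injective.\<close>
  have notin: "(b, z) \<notin> M" if "M \<in> completions (Y - {a}) R" for a b M
    using completions_snd[OF that, of "(b, z)"] assms(4)[of z] by (metis less_irrefl snd_conv)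
  have fin: "finite (?C a)" for a
    using assms(1,2) by (simp add: finite_completions)
  have eq: "completions Y (insert z R) = completions (insert z Y) R \<union> (\<Union>a\<in>Y. ?C a)"
    using assms(3,4) by (rule completions_insert)
  have "completions (insert z Y) R \<inter> ?C a = {}" for a
    by (auto simp: completions_def)
  then have "completions (insert z Y) R \<inter> (\<Union>a\<in>Y. ?C a) = {}"
    by blast
  then have "completion_sum l A Y (insert z R) =
      completion_sum l A (insert z Y) R + (\<Sum>M\<in>(\<Union>a\<in>Y. ?C a). weight l A M)"
    unfolding completion_sum_def eq
    using assms(1,2) fin by (intro sum.union_disjoint) (simp_all add: finite_completions)
  also have "(\<Sum>M\<in>(\<Union>a\<in>Y. ?C a). weight l A M) = (\<Sum>a\<in>Y. \<Sum>M\<in>?C a. weight l A M)"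
  proof (rule sum.UNION_disjoint)
    show "\<forall>a\<in>Y. \<forall>b\<in>Y. a \<noteq> b \<longrightarrow> ?C a \<inter> ?C b = {}"
      using notin by blast
  qed (use assms(1) fin in auto)
  also have "\<dots> = (\<Sum>a\<in>Y. (- 1) ^ card {c \<in> Y. a < c} * l ^ (card Y - 1) * A a z *
      completion_sum l A (Y - {a}) R)"
  proof (rule sum.cong[OF refl])
    fix a assume a: "a \<in> Y"
    have "inj_on (insert (a, z)) (completions (Y - {a}) R)"
      using notin by (intro inj_onI) (metis insert_ident)
    moreover have "weight l A (insert (a, z) M) =
        (- 1) ^ card {c \<in> Y. a < c} * l ^ (card Y - 1) * A a z * weight l A M"
      if "M \<in> completions (Y - {a}) R" for M
      using assms a that by (rule weight_insert)
    ultimately show "(\<Sum>M\<in>?C a. weight l A M) = (- 1) ^ card {c \<in> Y. a < c} * l ^ (card Y - 1) * A a z *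
        completion_sum l A (Y - {a}) R"
      by (simp add: sum.reindex completion_sum_def sum_distrib_left)
  qed
  finally show ?thesis .
qed

lemma completion_sum_Suc:
  assumes "Y \<subseteq> {..k}" "k < N"
  shows "completion_sum l A Y {k<..N} = completion_sum l A (insert (Suc k) Y) {Suc k<..N} +
    (\<Sum>a\<in>Y. (- 1) ^ card {c \<in> Y. a < c} * l ^ (card Y - 1) * A a (Suc k) *
      completion_sum l A (Y - {a}) {Suc k<..N})"
proof -
  have "{k<..N} = insert (Suc k) {Suc k<..N}"
    using assms(2) by auto
  moreover have "finite Y"
    using assms(1) finite_subset by blast
  ultimately show ?thesis
    using completion_sum_insert[of Y "{Suc k<..N}" "Suc k" l A] assms(1) by force
qed

text \<open>Each point changes the number of open endpoints by exactly one, so vanishing at both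
  neighbouring sizes propagates one point to the left.\<close>

lemma completion_sum_Suc_eq_0:
  assumes "Y \<subseteq> {..k}" "k < N"
    and "\<And>X. \<lbrakk>X \<subseteq> {..Suc k}; Suc (card X) = card Y \<or> card X = Suc (card Y)\<rbrakk>
      \<Longrightarrow> completion_sum l A X {Suc k<..N} = 0"
  shows "completion_sum l A Y {k<..N} = 0"
proof -
  have fin: "finite Y" and "Suc k \<notin> Y"
    using assms(1) finite_subset by auto
  have "completion_sum l A (insert (Suc k) Y) {Suc k<..N} = 0"
    using fin \<open>Suc k \<notin> Y\<close> assms(1) by (intro assms(3)) auto
  moreover have "completion_sum l A (Y - {a}) {Suc k<..N} = 0" if "a \<in> Y" for a
    using fin that assms(1) card_Suc_Diff1[OF fin that] by (intro assms(3)) auto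
  ultimately show ?thesis
    by (simp add: completion_sum_Suc[OF assms(1,2)])
qed

section \<open>The recursion for one, two and three open endpoints\<close>

lemma completion_sum_singleton:
  fixes l :: "'a::comm_ring_1"
  assumes "a \<le> k" "k < N"
  shows "completion_sum l A {a} {k<..N} = completion_sum l A {a, Suc k} {Suc k<..N} +
    A a (Suc k) * completion_sum l A {} {Suc k<..N}"
proof -
  have sets: "{c \<in> {a}. a < c} = {}" "insert (Suc k) {a} = {a, Suc k}" by auto
  have sum: "(\<Sum>e\<in>{a}. f e) = f a" for f :: "nat \<Rightarrow> 'a"
    by simp
  show ?thesis
    using completion_sum_Suc[of "{a}" k N l A] assms unfolding sum sets by simp
qed

lemma completion_sum_doubleton:
  fixes l :: "'a::comm_ring_1"
  assumes "a < b" "b \<le> k" "k < N"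
  shows "completion_sum l A {a, b} {k<..N} = completion_sum l A {a, b, Suc k} {Suc k<..N} +
    l * (A b (Suc k) * completion_sum l A {a} {Suc k<..N}
       - A a (Suc k) * completion_sum l A {b} {Suc k<..N})"
proof -
  \<comment> \<open>Closing \<open>a\<close> passes over \<open>b\<close> and gets a minus sign;
    closing \<open>b\<close> passes over nothing.\<close>
  have sets: "{c \<in> {a, b}. a < c} = {b}" "{c \<in> {a, b}. b < c} = {}" "{a, b} - {a} = {b}" "{a, b} - {b} = {a}"
    "insert (Suc k) {a, b} = {a, b, Suc k}"
    using assms(1) by auto
  have sum: "(\<Sum>e\<in>{a, b}. f e) = f a + f b" for f :: "nat \<Rightarrow> 'a"
    using assms(1) by simp
  show ?thesis
    using completion_sum_Suc[of "{a, b}" k N l A] assms unfolding sum sets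
    by (simp add: algebra_simps)
qed

lemma completion_sum_triple:
  fixes l :: "'a::comm_ring_1"
  assumes "a < b" "b < c" "c \<le> k" "k < N"
  shows "completion_sum l A {a, b, c} {k<..N} = completion_sum l A {a, b, c, Suc k} {Suc k<..N} +
    l\<^sup>2 * (A a (Suc k) * completion_sum l A {b, c} {Suc k<..N}
        - A b (Suc k) * completion_sum l A {a, c} {Suc k<..N}
        + A c (Suc k) * completion_sum l A {a, b} {Suc k<..N})"
proof -
  \<comment> \<open>Two, one and no open endpoints lie to the right of \<open>a\<close>,
    \<open>b\<close> and \<open>c\<close>, so the signs alternate.\<close>
  have sets: "{d \<in> {a, b, c}. a < d} = {b, c}" "{d \<in> {a, b, c}. b < d} = {c}" "{d \<in> {a, b, c}. c < d} = {}"
    "{a, b, c} - {a} = {b, c}" "{a, b, c} - {b} = {a, c}" "{a, b, c} - {c} = {a, b}"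
    "insert (Suc k) {a, b, c} = {a, b, c, Suc k}"
    using assms(1,2) by auto
  have sum: "(\<Sum>e\<in>{a, b, c}. f e) = f a + f b + f c" for f :: "nat \<Rightarrow> 'a"
    using assms(1,2) by (simp add: add.assoc)
  show ?thesis
    using completion_sum_Suc[of "{a, b, c}" k N l A] assms
    unfolding sum sets
    by (simp add: algebra_simps power2_eq_square)
qed

section \<open>Closed forms, by parity of the number of open endpoints\<close>

lemma card_3_nat_obtain:
  assumes "card (Y :: nat set) = 3"
  obtains a b c where "Y = {a, b, c}" "a < b" "b < c"
proof -
  obtain u v w where "Y = {u, v, w}" "u \<noteq> v" "v \<noteq> w" "u \<noteq> w"
    using assms by (auto simp: card_3_iff)
  then show thesis
    using that[of u v w] that[of u w v] that[of v u w] that[of v w u] that[of w u v] that[of w v u]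
    by (metis insert_commute linorder_neqE_nat)
qed

text \<open>The value at one open endpoint is a linear functional of \<open>(1, x a)\<close> that
  vanishes at \<open>(1, x (Suc k))\<close>, so the scalar \<open>K\<close> determines it.\<close>

definition odd_state :: "'a::comm_ring_1 \<Rightarrow> (nat \<Rightarrow> 'a) \<Rightarrow> nat \<Rightarrow> nat \<Rightarrow> 'a \<Rightarrow> bool" where
  "odd_state l x N k K \<longleftrightarrow>
     (\<forall>Y\<subseteq>{..k}. odd (card Y) \<and> card Y \<ge> 3 \<longrightarrow> completion_sum l (\<lambda>i j. x i - x j) Y {k<..N} = 0) \<and>
     (\<forall>a\<le>k. completion_sum l (\<lambda>i j. x i - x j) {a} {k<..N} = (x a - x (Suc k)) * K)"

text \<open>On pairs the value is an alternating form in \<open>(1, x a)\<close> and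
  \<open>(1, x b)\<close>, hence a multiple \<open>C\<close> of their determinant (up to
  sign).\<close>

definition even_state :: "'a::comm_ring_1 \<Rightarrow> (nat \<Rightarrow> 'a) \<Rightarrow> nat \<Rightarrow> nat \<Rightarrow> 'a \<Rightarrow> 'a \<Rightarrow> bool" where
  "even_state l x N k C D \<longleftrightarrow>
     (\<forall>Y\<subseteq>{..k}. even (card Y) \<and> card Y \<ge> 4 \<longrightarrow> completion_sum l (\<lambda>i j. x i - x j) Y {k<..N} = 0) \<and>
     (\<forall>a b. a < b \<and> b \<le> k \<longrightarrow> completion_sum l (\<lambda>i j. x i - x j) {a, b} {k<..N} = (x a - x b) * C) \<and>
     completion_sum l (\<lambda>i j. x i - x j) {} {k<..N} = D"

lemma even_state_init: "even_state l x N N 0 1"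
  by (auto simp: even_state_def completion_sum_empty)

text \<open>For one open endpoint, opening an arc at \<open>Suc k\<close> contributes
  \<open>C\<close> and closing one contributes \<open>D\<close>, both times
  \<open>x a - x (Suc k)\<close>, so the scalars add.\<close>

lemma odd_state_step:
  assumes "even_state l x N (Suc k) C D" "k < N"
  shows "odd_state l x N k (C + D)"
proof -
  let ?W = "completion_sum l (\<lambda>i j. x i - x j)"
  have E0: "\<And>Y. \<lbrakk>Y \<subseteq> {..Suc k}; even (card Y); card Y \<ge> 4\<rbrakk> \<Longrightarrow> ?W Y {Suc k<..N} = 0"
    and E2: "\<And>a b. \<lbrakk>a < b; b \<le> Suc k\<rbrakk> \<Longrightarrow> ?W {a, b} {Suc k<..N} = (x a - x b) * C"
    and E1: "?W {} {Suc k<..N} = D"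
    using assms(1) unfolding even_state_def by blast+
  have "?W Y {k<..N} = 0" if Y: "Y \<subseteq> {..k}" "odd (card Y)" "card Y \<ge> 3" for Y
  \<comment> \<open>Size three needs a computation, because closing one arc leaves a pair, whose
    value need not vanish.\<close>
  proof (cases "card Y = 3")
    case True
    then obtain a b c where abc: "Y = {a, b, c}" "a < b" "b < c"
      by (rule card_3_nat_obtain)
    then have "c \<le> k" using Y(1) by simp
    moreover have "?W {a, b, c, Suc k} {Suc k<..N} = 0"
      using abc \<open>c \<le> k\<close> by (intro E0) auto
    \<comment> \<open>With \<open>p = Suc k\<close>, the three closing terms cancel by the Pluecker
      relation \<open>(x a - x p) * (x b - x c) - (x b - x p) * (x a - x c) + (x c - x p) * (x a - x
      b) = 0\<close>.\<close>
    ultimately show ?thesis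
      using abc assms(2) by (simp add: completion_sum_triple E2 algebra_simps)
  next
    case False
    with Y have "card Y \<ge> 5"
      by (cases "card Y = 4") auto
    show ?thesis
    proof (rule completion_sum_Suc_eq_0[OF Y(1) assms(2)])
      fix X assume X: "X \<subseteq> {..Suc k}" "Suc (card X) = card Y \<or> card X = Suc (card Y)"
      then have "even (card X)"
        using Y(2) by (metis even_Suc)
      then show "?W X {Suc k<..N} = 0"
        using X \<open>card Y \<ge> 5\<close> by (intro E0) auto
    qed
  qed
  moreover have "?W {a} {k<..N} = (x a - x (Suc k)) * (C + D)" if "a \<le> k" for a
    using that assms(2) by (simp add: completion_sum_singleton E1 E2 algebra_simps)
  ultimately show ?thesis
    unfolding odd_state_def by blast
qed

text \<open>Put \<open>p = Suc k\<close> and \<open>q = Suc (Suc k)\<close>. With two open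
  endpoints, \<open>(x b - x p) * (x a - x q) - (x a - x p) * (x b - x q)\<close> equals
  \<open>- (x a - x b) * (x p - x q)\<close>, which gives \<open>C\<close>. With none,
  \<open>p\<close> must open an arc, and the formula for one open endpoint at \<open>p\<close> gives
  \<open>D\<close>.\<close>

lemma even_state_step:
  assumes "odd_state l x N (Suc k) K" "k < N"
  shows "even_state l x N k (- l * (x (Suc k) - x (Suc (Suc k))) * K)
    ((x (Suc k) - x (Suc (Suc k))) * K)"
proof -
  let ?W = "completion_sum l (\<lambda>i j. x i - x j)"
  have O0: "\<And>Y. \<lbrakk>Y \<subseteq> {..Suc k}; odd (card Y); card Y \<ge> 3\<rbrakk> \<Longrightarrow> ?W Y {Suc k<..N} = 0"
    and O1: "\<And>a. a \<le> Suc k \<Longrightarrow> ?W {a} {Suc k<..N} = (x a - x (Suc (Suc k))) * K"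
    using assms(1) unfolding odd_state_def by blast+
  have "?W Y {k<..N} = 0" if Y: "Y \<subseteq> {..k}" "even (card Y)" "card Y \<ge> 4" for Y
  proof (rule completion_sum_Suc_eq_0[OF Y(1) assms(2)])
    fix X assume X: "X \<subseteq> {..Suc k}" "Suc (card X) = card Y \<or> card X = Suc (card Y)"
    then have "odd (card X)"
      using Y(2) by (metis even_Suc)
    then show "?W X {Suc k<..N} = 0"
      \<comment> \<open>The neighbours of an even size of at least 4 are at least 3, so no
        exceptional size occurs here.\<close>
      using X Y(3) by (intro O0) auto
  qed
  moreover have "?W {a, b} {k<..N} = (x a - x b) * (- l * (x (Suc k) - x (Suc (Suc k))) * K)"
    if "a < b" "b \<le> k" for a b
  proof -
    have "?W {a, b, Suc k} {Suc k<..N} = 0"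
      using that by (intro O0) auto
    then show ?thesis
      using that assms(2) by (simp add: completion_sum_doubleton O1 algebra_simps)
  qed
  moreover have "?W {} {k<..N} = (x (Suc k) - x (Suc (Suc k))) * K"
    using completion_sum_Suc[of "{}" k N l "\<lambda>i j. x i - x j"] assms(2) by (simp add: O1)
  ultimately show ?thesis
    unfolding even_state_def by blast
qed

text \<open>Two steps to the left replace \<open>K\<close> by
  \<open>- l * d * K + d * K = (1 - l) * d * K\<close>, where \<open>d\<close> is the difference for
  the pair just absorbed. The induction descends from \<open>j = n - 1\<close>, where only the point
  \<open>2 * n\<close> remains.\<close>

lemma odd_state_product:
  assumes "j < n"
  shows "odd_state l x (2 * n) (Suc (2 * j))
    ((1 - l) ^ (n - Suc j) * (\<Prod>i = Suc (Suc j)..n. (x (2 * i - 1) - x (2 * i))))"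
proof -
  define \<kappa> where
    "\<kappa> j = (1 - l) ^ (n - Suc j) * (\<Prod>i = Suc (Suc j)..n. (x (2 * i - 1) - x (2 * i)))" for j
  have "j \<le> n - 1"
    using assms by simp
  then have "odd_state l x (2 * n) (Suc (2 * j)) (\<kappa> j)"
  proof (induction j rule: inc_induct)
    case base
    have "Suc (Suc (2 * (n - 1))) = 2 * n" using assms by simp
    \<comment> \<open>The summands are \<open>C\<close> and \<open>D\<close> of the state after the
      last point.\<close>
    moreover have "\<kappa> (n - 1) = 0 + 1" using assms by (simp add: \<kappa>_def)
    ultimately show ?case
      using odd_state_step[of l x "2 * n" "Suc (2 * (n - 1))" 0 1] even_state_init[of l x "2 * n"]
        assms by simp
  next
    case (step j)
    let ?d = "x (2 * Suc (Suc j) - 1) - x (2 * Suc (Suc j))"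
    have d: "x (Suc (2 * Suc j)) - x (Suc (Suc (2 * Suc j))) = ?d"
      by simp
    have "even_state l x (2 * n) (Suc (Suc (2 * j)))
        (- l * ?d * \<kappa> (Suc j)) (?d * \<kappa> (Suc j))"
      using even_state_step[of l x "2 * n" "2 * Suc j" "\<kappa> (Suc j)"] step unfolding d by simp
    then have "odd_state l x (2 * n) (Suc (2 * j)) (- l * ?d * \<kappa> (Suc j) + ?d * \<kappa> (Suc j))"
      using step by (intro odd_state_step) auto
    moreover have "\<kappa> j = - l * ?d * \<kappa> (Suc j) + ?d * \<kappa> (Suc j)"
    proof -
      have "n - Suc j = Suc (n - Suc (Suc j))"
        and "{Suc (Suc j)..n} = insert (Suc (Suc j)) {Suc (Suc (Suc j))..n}"
        using step by auto
      then show ?thesis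
        unfolding \<kappa>_def by (simp add: algebra_simps)
    qed
    ultimately show ?case by simp
  qed
  then show ?thesis
    by (simp add: \<kappa>_def)
qed

theorem corollary7:
  fixes l :: "'a::comm_ring_1" and x :: "nat \<Rightarrow> 'a" and n :: nat
  assumes "n \<ge> 1"
  shows "lambda_Pf l n (\<lambda>i j. x i - x j) =
    (1 - l) ^ (n - 1) * (\<Prod>i = 1..n. (x (2 * i - 1) - x (2 * i)))"
proof -
  let ?K = "(1 - l) ^ (n - 1) * (\<Prod>i = 2..n. (x (2 * i - 1) - x (2 * i)))"
  have "odd_state l x (2 * n) (Suc 0) ?K"
    using odd_state_product[of 0 n l x] assms by (simp add: numeral_2_eq_2)
  \<comment> \<open>The final step to \<open>k = 0\<close> reads off \<open>D\<close> alone: it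
    supplies \<open>x 1 - x 2\<close> but no factor \<open>1 - l\<close>, whence the exponent
    \<open>n - 1\<close>.\<close>
  then have "completion_sum l (\<lambda>i j. x i - x j) {} {0<..2 * n} = (x 1 - x 2) * ?K"
    using even_state_step[of l x "2 * n" 0 ?K] assms
    by (simp add: even_state_def numeral_2_eq_2)
  moreover have "{0<..2 * n} = {1..2 * n}"
    by auto
  moreover have "{1..n} = insert 1 {2..n}"
    using assms by auto
  ultimately show ?thesis
    by (simp add: lambda_Pf_eq_completion_sum mult_ac)
qed

end
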